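(* Let $\mu\in\Delta_m$, $\nu\in\Delta_n$ have positive entries, $C\in\mathbb R^{m\times n}$, and let $(f(t),g(t))_{t\ge0}$ be the cold Sinkhorn dynamics from any initial pair $(\bar f^0,\bar g^0)\in\partial\mathcal F$, with associated $(t_\ell,\bar v^\ell,\bar w^\ell,\mathcal E^\ell)_{\ell\le L}$. Then at the final phase $(\bar v^L,\bar w^L)=(0,0)$, and the final point $(f(t_L),g(t_L))$ is an optimal solution of the dual optimal transport problem $$\max_{f\in\mathbb R^m,\,g\in\mathbb R^n} f^\top\mu+g^\top\nu\quad\text{subject to}\quad f_i+g_j\le C_{ij}\ \ \forall i,j.$$
   Context: $\Delta_N$ is the probability simplex in $\mathbb R^N$; $H(p|q)=\sum_I p_I\log(p_I/q_I)$ is relative entropy. **Dual OT polytope.** $\mathcal F=\{(f,g)\in\mathbb R^m\times\mathbb R^n:\ f_i+g_j\le C_{ij}\ \forall i,j\}$; $\partial\mathcal F$ is its Pareto frontier: the set of $(f,g)\in\mathcal F$ such that the only $(f',g')\in\mathcal F$ with $f'_i\ge f_i$ and $g'_j\ge g_j$ for all $i,j$ is $(f,g)$ itself. **The vectors $v^*(\mathcal E),w^*(\mathcal E)$.** For $\mathcal E\subset\{1,\dots,m\}\times\{1,\dots,n\}$, $\Delta_{\mathcal E}$ is the set of probability distributions on $\mathcal E$; for $\pi\in\Delta_{\mathcal E}$, $(X_\sharp\pi)_i=\sum_{j:(i,j)\in\mathcal E}\pi_{ij}$ and $(Y_\sharp\pi)_j=\sum_{i:(i,j)\in\mathcal E}\pi_{ij}$.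 If the bipartite graph on $\{1,\dots,m\}\sqcup\{1,\dots,n\}$ with edge set $\mathcal E$ has no isolated vertex, let $\mu^*(\mathcal E)$ be the minimizer of $H(\bar\mu|\mu)$ over $\bar\mu$ such that there is $Q\in\Delta_{\mathcal E}$ with $X_\sharp Q=\bar\mu$, $Y_\sharp Q=\nu$; let $\nu^*(\mathcal E)$ be the minimizer of $H(\bar\nu|\nu)$ over $\bar\nu$ such that there is $P\in\Delta_{\mathcal E}$ with $X_\sharp P=\mu$, $Y_\sharp P=\bar\nu$; and $v^*(\mathcal E)_i=\log(\mu_i/\mu^*_i(\mathcal E))$, $w^*(\mathcal E)_j=\log(\nu_j/\nu^*_j(\mathcal E))$. **Cold Sinkhorn dynamics.** For $(\bar f^0,\bar g^0)\in\partial\mathcal F$, it is the continuous curve with $f(0)=\bar f^0$, $g(0)=\bar g^0$ and $\frac{d}{dt}f(t)=\bar v^\ell$, $\frac{d}{dt}g(t)=\bar w^\ell$ for $t\in[t_\ell,t_{\ell+1})$, $\ell\le L$, where $(t_\ell,\bar v^\ell,\bar w^\ell,\mathcal E^\ell)_{\ell\le L}$ is defined recursively: $t_0=0$, $\mathcal E^0=\{(i,j):\bar f^0_i+\bar g^0_j-C_{ij}=0\}$, $\bar v^0=v^*(\mathcal E^0)$, $\bar w^0=w^*(\mathcal E^0)$; and for $\ell\ge0$, $$t_{\ell+1}=\inf\Big\{t\ge t_\ell:\ \max_{(i,j)\notin\mathcal E^\ell} f_i(t_\ell)+g_j(t_\ell)+(t-t_\ell)(\bar v^\ell_i+\bar w^\ell_j)-C_{ij}\ge0\Big\}.$$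 If $t_{\ell+1}<\infty$, then $\mathcal E^{\ell+1}=\{(i,j): f_i(t_\ell)+g_j(t_\ell)+(t_{\ell+1}-t_\ell)(\bar v^\ell_i+\bar w^\ell_j)-C_{ij}=0\}$, $\bar v^{\ell+1}=v^*(\mathcal E^{\ell+1})$, $\bar w^{\ell+1}=w^*(\mathcal E^{\ell+1})$. If $t_{\ell+1}=\infty$, then $L=\ell$ and the sequence stops. Set $t_{L+1}=\infty$. (All the sets $\mathcal E^\ell$ arising have no isolated vertex, and $L$ is finite.) *)

theory Defs
  imports "HOL-Analysis.Analysis"
begin

definition prob_simplex :: "(real ^ 'k) set" where
  "prob_simplex = {p. (\<forall>k. 0 \<le> p $ k) \<and> (\<Sum>k\<in>UNIV. p $ k) = 1}"

text \<open>Only used with a reference vector \<open>q\<close> having positive entries, so the value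
  \<open>+\<infinity>\<close> never arises. The convention \<open>0 log 0 = 0\<close> holds because of the factor \<open>p $ k\<close>.\<close>

definition rel_entropy :: "real ^ 'k \<Rightarrow> real ^ 'k \<Rightarrow> real" where
  "rel_entropy p q = (\<Sum>k\<in>UNIV. p $ k * ln (p $ k / q $ k))"

definition dual_polytope :: "real ^ 'n ^ 'm \<Rightarrow> ((real ^ 'm) \<times> (real ^ 'n)) set" where
  "dual_polytope C = {(f, g). \<forall>i j. f $ i + g $ j \<le> C $ i $ j}"

definition pareto_frontier :: "real ^ 'n ^ 'm \<Rightarrow> ((real ^ 'm) \<times> (real ^ 'n)) set" where
  "pareto_frontier C =
     {(f, g). (f, g) \<in> dual_polytope C \<and>
        (\<forall>f' g'. (f', g') \<in> dual_polytope C \<longrightarrow> (\<forall>i. f $ i \<le> f' $ i) \<longrightarrow> (\<forall>j. g $ j \<le> g' $ j)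
           \<longrightarrow> (f', g') = (f, g))}"

text \<open>A distribution on \<open>E\<close> is represented by its extension by zero to all index pairs.\<close>

definition dist_on :: "('m \<times> 'n) set \<Rightarrow> (real ^ 'n ^ 'm) set" where
  "dist_on E = {\<pi>. (\<forall>(i, j)\<in>E. 0 \<le> \<pi> $ i $ j) \<and> (\<forall>(i, j)\<in>-E. \<pi> $ i $ j = 0)
                   \<and> (\<Sum>(i, j)\<in>E. \<pi> $ i $ j) = 1}"

definition X_push :: "('m \<times> 'n) set \<Rightarrow> real ^ 'n ^ 'm \<Rightarrow> real ^ 'm" where
  "X_push E \<pi> = (\<chi> i. \<Sum>j | (i, j) \<in> E. \<pi> $ i $ j)"

definition Y_push :: "('m \<times> 'n) set \<Rightarrow> real ^ 'n ^ 'm \<Rightarrow> real ^ 'n" where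
  "Y_push E \<pi> = (\<chi> j. \<Sum>i | (i, j) \<in> E. \<pi> $ i $ j)"

text \<open>The minimizers below exist and are unique when \<open>\<mu>\<close> and \<open>\<nu>\<close> are probability vectors with
  positive entries and every vertex of the bipartite graph with edge set \<open>E\<close> is incident to
  an edge; otherwise the values are unspecified.\<close>

definition mu_star :: "real ^ 'm \<Rightarrow> real ^ 'n \<Rightarrow> ('m \<times> 'n) set \<Rightarrow> real ^ 'm" where
  "mu_star \<mu> \<nu> E =
     (THE m. is_arg_min (\<lambda>x. rel_entropy x \<mu>)
               (\<lambda>x. \<exists>Q\<in>dist_on E. X_push E Q = x \<and> Y_push E Q = \<nu>) m)"

definition nu_star :: "real ^ 'm \<Rightarrow> real ^ 'n \<Rightarrow> ('m \<times> 'n) set \<Rightarrow> real ^ 'n" where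
  "nu_star \<mu> \<nu> E =
     (THE n. is_arg_min (\<lambda>y. rel_entropy y \<nu>)
               (\<lambda>y. \<exists>P\<in>dist_on E. X_push E P = \<mu> \<and> Y_push E P = y) n)"

definition v_star :: "real ^ 'm \<Rightarrow> real ^ 'n \<Rightarrow> ('m \<times> 'n) set \<Rightarrow> real ^ 'm" where
  "v_star \<mu> \<nu> E = (\<chi> i. ln (\<mu> $ i / mu_star \<mu> \<nu> E $ i))"

definition w_star :: "real ^ 'm \<Rightarrow> real ^ 'n \<Rightarrow> ('m \<times> 'n) set \<Rightarrow> real ^ 'n" where
  "w_star \<mu> \<nu> E = (\<chi> j. ln (\<nu> $ j / nu_star \<mu> \<nu> E $ j))"

text \<open>Signed constraint violation (nonpositive on the polytope) after moving from \<open>(f, g)\<close> for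
  time \<open>d\<close> with constant velocity \<open>(v, w)\<close>.\<close>

definition violation ::
  "real ^ 'n ^ 'm \<Rightarrow> real ^ 'm \<Rightarrow> real ^ 'n \<Rightarrow> real ^ 'm \<Rightarrow> real ^ 'n \<Rightarrow> real \<Rightarrow> 'm \<Rightarrow> 'n \<Rightarrow> real" where
  "violation C f g v w d i j = f $ i + g $ j + d * (v $ i + w $ j) - C $ i $ j"

text \<open>The times \<open>t l\<close> are extended reals, so that the infimum of the empty set is \<open>\<infinity>\<close>. The maximum
  over \<open>(i, j) \<notin> E\<close> is a supremum in the extended reals: it is \<open>-\<infinity>\<close> if \<open>E\<close> contains all
  pairs, and then the next time is \<open>\<infinity>\<close>. The sequences \<open>v\<close>, \<open>w\<close>, \<open>E\<close> are only constrained up to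
  index \<open>L\<close>, and \<open>t\<close> up to \<open>Suc L\<close>; the curves are only constrained on \<open>[0, \<infinity>)\<close>. The derivative
  within \<open>[t l, t (Suc l))\<close> is two-sided in the interior and one-sided at \<open>t l\<close>.\<close>

definition cold_sinkhorn ::
  "real ^ 'm \<Rightarrow> real ^ 'n \<Rightarrow> real ^ 'n ^ 'm \<Rightarrow> real ^ 'm \<Rightarrow> real ^ 'n
   \<Rightarrow> (real \<Rightarrow> real ^ 'm) \<Rightarrow> (real \<Rightarrow> real ^ 'n)
   \<Rightarrow> nat \<Rightarrow> (nat \<Rightarrow> ereal) \<Rightarrow> (nat \<Rightarrow> real ^ 'm) \<Rightarrow> (nat \<Rightarrow> real ^ 'n)
   \<Rightarrow> (nat \<Rightarrow> ('m \<times> 'n) set) \<Rightarrow> bool" where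
  "cold_sinkhorn \<mu> \<nu> C f0 g0 f g L t v w E \<longleftrightarrow>
     continuous_on {0..} f \<and> continuous_on {0..} g \<and> f 0 = f0 \<and> g 0 = g0 \<and>
     (\<forall>l\<le>L. \<forall>s. t l \<le> ereal s \<and> ereal s < t (Suc l) \<longrightarrow>
        (f has_vector_derivative v l) (at s within {r. t l \<le> ereal r \<and> ereal r < t (Suc l)}) \<and>
        (g has_vector_derivative w l) (at s within {r. t l \<le> ereal r \<and> ereal r < t (Suc l)})) \<and>
     t 0 = 0 \<and>
     E 0 = {(i, j). f0 $ i + g0 $ j - C $ i $ j = 0} \<and>
     (\<forall>l\<le>L. v l = v_star \<mu> \<nu> (E l) \<and> w l = w_star \<mu> \<nu> (E l)) \<and>
     (\<forall>l\<le>L. t (Suc l) = Inf {ereal s | s. t l \<le> ereal s \<and>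
        (SUP (i, j)\<in>-E l. ereal (violation C (f (real_of_ereal (t l))) (g (real_of_ereal (t l)))
            (v l) (w l) (s - real_of_ereal (t l)) i j)) \<ge> 0}) \<and>
     (\<forall>l<L. t (Suc l) < \<infinity> \<and>
        E (Suc l) = {(i, j). violation C (f (real_of_ereal (t l))) (g (real_of_ereal (t l)))
            (v l) (w l) (real_of_ereal (t (Suc l)) - real_of_ereal (t l)) i j = 0}) \<and>
     t (Suc L) = \<infinity>"

end

theory Submission
  imports Defs
begin

text \<open>Fix an edge set \<open>E\<close> touching every vertex. A distribution \<open>Q\<close> on \<open>E\<close> with second marginal \<open>\<nu>\<close>
  whose first marginal is \<open>\<mu>\<^sup>* = mu_star \<mu> \<nu> E\<close> satisfies an exchange condition: each \<open>j\<close> receives its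
  mass only from those neighbours \<open>i\<close> at which \<open>v\<^sub>i = ln (\<mu>\<^sub>i / \<mu>\<^sup>*\<^sub>i)\<close> is maximal. The reweighted
  matrix with entries \<open>exp (v\<^sub>i) Q\<^sub>i\<^sub>j\<close> has first marginal \<open>\<mu>\<close> and satisfies the same condition with
  the two sides exchanged. Hence it solves the problem defining \<open>nu_star\<close>, and \<open>w_star\<close> turns out
  to be \<open>w\<^sub>j = - max {v\<^sub>i | i. (i, j) \<in> E}\<close>. This is the heart of the proof: the two velocities,
  defined by two unrelated-looking problems, obey \<open>v\<^sub>i + w\<^sub>j \<le> 0\<close> on \<open>E\<close>, with equality on the
  support of \<open>Q\<close>, which touches every vertex. These relations are the predicate \<open>complementary\<close>;
  it is symmetric by \<open>complementary_converse\<close>, it has a solution by \<open>exists_complementary\<close>, and a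
  Pythagorean inequality shows in \<open>complementary_imp_mu_star\<close> that any solution is given by
  \<open>v_star\<close> and \<open>w_star\<close>.

  Along the dynamics \<open>E\<close> is the set of tight constraints. Nonpositivity on \<open>E\<close> keeps these
  constraints satisfied, the stopping rule keeps the other ones satisfied, and the edges with
  \<open>v\<^sub>i + w\<^sub>j = 0\<close> remain tight, so no vertex becomes isolated at a change of phase
  (\<open>phase_state_step\<close>).

  In the last phase no new constraint is ever reached, so \<open>v\<^sub>i + w\<^sub>j \<le> 0\<close> for all pairs; averaged
  against \<open>\<mu>\<close> and \<open>\<nu>\<close>, the dual objective does not increase. Its rate of change however is
  \<open>\<Sum>\<mu>\<^sub>i v\<^sub>i + \<Sum>\<nu>\<^sub>j w\<^sub>j = H(\<mu>|\<mu>\<^sup>*) + H(\<nu>|\<nu>\<^sup>*)\<close>, which is nonnegative and vanishes only for \<open>v = 0\<close>,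
  \<open>w = 0\<close> (\<open>complementary_eq_0_if_nonpos\<close>). Then \<open>Q\<close> is a coupling of \<open>\<mu>\<close> and \<open>\<nu>\<close> supported on tight
  constraints, and complementary slackness gives optimality.\<close>

section \<open>Distributions on an edge set\<close>

lemma dist_on_iff:
  "Q \<in> dist_on E \<longleftrightarrow>
     (\<forall>i j. 0 \<le> Q $ i $ j) \<and> (\<forall>i j. (i, j) \<notin> E \<longrightarrow> Q $ i $ j = 0) \<and>
     (\<Sum>i\<in>UNIV. \<Sum>j\<in>UNIV. Q $ i $ j) = 1"
proof -
  have unfolded: "Q \<in> dist_on E \<longleftrightarrow> (\<forall>i j. (i, j) \<in> E \<longrightarrow> 0 \<le> Q $ i $ j) \<and>
      (\<forall>i j. (i, j) \<notin> E \<longrightarrow> Q $ i $ j = 0) \<and> (\<Sum>(i, j)\<in>E. Q $ i $ j) = 1"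
    by (simp add: dist_on_def Ball_def)
  show ?thesis
  proof (cases "\<forall>i j. (i, j) \<notin> E \<longrightarrow> Q $ i $ j = 0")
    case True
    have "(\<Sum>(i, j)\<in>E. Q $ i $ j) = (\<Sum>(i, j)\<in>UNIV. Q $ i $ j)"
      by (rule sum.mono_neutral_left) (use True in auto)
    also have "\<dots> = (\<Sum>i\<in>UNIV. \<Sum>j\<in>UNIV. Q $ i $ j)"
      by (simp add: sum.cartesian_product)
    finally have total: "(\<Sum>(i, j)\<in>E. Q $ i $ j) = (\<Sum>i\<in>UNIV. \<Sum>j\<in>UNIV. Q $ i $ j)" .
    have "0 \<le> Q $ i $ j" if "(i, j) \<in> E \<Longrightarrow> 0 \<le> Q $ i $ j" for i j
      using that True by (cases "(i, j) \<in> E") simp_all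
    then show ?thesis
      unfolding unfolded total by blast
  next
    case False
    then show ?thesis
      unfolding unfolded by blast
  qed
qed

lemma X_push_eq_row_sum:
  assumes "Q \<in> dist_on E"
  shows "X_push E Q $ i = (\<Sum>j\<in>UNIV. Q $ i $ j)"
  unfolding X_push_def vec_lambda_beta
  by (rule sum.mono_neutral_left) (use assms in \<open>auto simp: dist_on_iff\<close>)

lemma Y_push_eq_column_sum:
  assumes "Q \<in> dist_on E"
  shows "Y_push E Q $ j = (\<Sum>i\<in>UNIV. Q $ i $ j)"
  unfolding Y_push_def vec_lambda_beta
  by (rule sum.mono_neutral_left) (use assms in \<open>auto simp: dist_on_iff\<close>)

lemma transpose_in_dist_on_converse:
  "transpose Q \<in> dist_on (E\<inverse>) \<longleftrightarrow> Q \<in> dist_on E"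
proof -
  have "(\<Sum>i\<in>UNIV. \<Sum>j\<in>UNIV. transpose Q $ i $ j) = (\<Sum>i\<in>UNIV. \<Sum>j\<in>UNIV. Q $ i $ j)"
    by (subst sum.swap) (simp add: transpose_def)
  then show ?thesis
    unfolding dist_on_iff by (auto simp: transpose_def)
qed

lemma push_converse_transpose:
  "X_push (E\<inverse>) (transpose Q) = Y_push E Q"
  "Y_push (E\<inverse>) (transpose Q) = X_push E Q"
  by (simp_all add: X_push_def Y_push_def transpose_def vec_eq_iff)

text \<open>Exchanging the two sides of the graph turns the problem for \<open>\<nu>\<^sup>*\<close> into one for \<open>\<mu>\<^sup>*\<close>, so that only
  the latter has to be analysed.\<close>

lemma nu_star_eq_mu_star_converse:
  "nu_star \<mu> \<nu> E = mu_star \<nu> \<mu> (E\<inverse>)"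
proof -
  have "(\<exists>P\<in>dist_on E. X_push E P = \<mu> \<and> Y_push E P = y) \<longleftrightarrow>
        (\<exists>Q\<in>dist_on (E\<inverse>). X_push (E\<inverse>) Q = y \<and> Y_push (E\<inverse>) Q = \<mu>)" for y
    by (metis transpose_in_dist_on_converse push_converse_transpose transpose_transpose)
  then show ?thesis
    unfolding nu_star_def mu_star_def by simp
qed

section \<open>Relative entropy\<close>

text \<open>Summed over the entries of two vectors of equal mass, this inequality and its equality case
  are Gibbs' inequality.\<close>

lemma mult_ln_ratio_ge:
  fixes x q :: real
  assumes "0 \<le> x" "0 < q"
  shows "x - q \<le> x * ln (x / q)"
proof (cases "x = 0")
  case False
  with assms have "ln (q / x) \<le> q / x - 1"
    by (intro ln_le_minus_one) auto
  then have "x * ln (q / x) \<le> x * (q / x - 1)"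
    using assms by (intro mult_left_mono)
  then show ?thesis
    using False assms by (simp add: ln_div algebra_simps)
qed (use assms in auto)

lemma mult_ln_ratio_eq_imp_eq:
  fixes x q :: real
  assumes "0 \<le> x" "0 < q" "x * ln (x / q) = x - q"
  shows "x = q"
proof (cases "x = 0")
  case False
  then have "x * ln (q / x) = x * (q / x - 1)"
    using assms by (simp add: ln_div algebra_simps)
  then have "ln (q / x) = q / x - 1"
    using False by simp
  then have "q / x = 1"
    using assms False by (intro ln_eq_minus_one) auto
  then show ?thesis
    using False by simp
qed (use assms in auto)

text \<open>The convex function \<open>y \<mapsto> y ln (y / q)\<close> lies above its tangent at \<open>a\<close>; the gap is
  \<open>y ln (y / a) - (y - a)\<close>.\<close>

lemma mult_ln_tangent:
  fixes a y q :: real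
  assumes "0 < a" "0 \<le> y" "0 < q"
  shows "a * ln (a / q) + (ln (a / q) + 1) * (y - a) \<le> y * ln (y / q)"
proof -
  have "y * ln (y / q) = y * ln (y / a) + y * ln (a / q)"
    using assms by (cases "y = 0") (auto simp: ln_div algebra_simps)
  with mult_ln_ratio_ge[of y a] assms show ?thesis
    by (simp add: algebra_simps)
qed

lemma rel_entropy_nonneg:
  assumes "\<And>k. 0 \<le> p $ k" "\<And>k. 0 < q $ k"
    and "(\<Sum>k\<in>UNIV. p $ k) = (\<Sum>k\<in>UNIV. q $ k)"
  shows "0 \<le> rel_entropy p q"
proof -
  have "(\<Sum>k\<in>UNIV. p $ k - q $ k) \<le> rel_entropy p q"
    unfolding rel_entropy_def by (intro sum_mono mult_ln_ratio_ge assms)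
  with assms(3) show ?thesis
    by (simp add: sum_subtractf)
qed

lemma rel_entropy_nonpos_imp_eq:
  assumes "\<And>k. 0 \<le> p $ k" "\<And>k. 0 < q $ k"
    and "(\<Sum>k\<in>UNIV. p $ k) = (\<Sum>k\<in>UNIV. q $ k)"
    and "rel_entropy p q \<le> 0"
  shows "p = q"
proof -
  have nn: "0 \<le> p $ k * ln (p $ k / q $ k) - (p $ k - q $ k)" for k
    using mult_ln_ratio_ge[of "p $ k" "q $ k"] assms by simp
  have "(\<Sum>k\<in>UNIV. p $ k * ln (p $ k / q $ k) - (p $ k - q $ k)) = 0"
  proof (rule antisym)
    show "(\<Sum>k\<in>UNIV. p $ k * ln (p $ k / q $ k) - (p $ k - q $ k)) \<le> 0"
      using assms(3,4) by (simp add: rel_entropy_def sum_subtractf)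
  qed (intro sum_nonneg nn)
  then have "p $ k * ln (p $ k / q $ k) - (p $ k - q $ k) = 0" for k
    by (subst (asm) sum_nonneg_eq_0_iff) (use nn in auto)
  then have "p $ k * ln (p $ k / q $ k) = p $ k - q $ k" for k
    by (simp only: right_minus_eq)
  then have "p $ k = q $ k" for k
    by (rule mult_ln_ratio_eq_imp_eq[OF assms(1,2)])
  then show ?thesis
    by (simp add: vec_eq_iff)
qed

lemma continuous_on_mult_ln_ratio:
  fixes q :: real
  assumes "0 < q"
  shows "continuous_on {0..} (\<lambda>x. x * ln (x / q))"
proof -
  have "continuous (at x within {0..}) (\<lambda>x. x * ln (x / q))" if "0 \<le> x" for x
  proof (cases "x = 0")
    case False
    with that assms have "isCont (\<lambda>x. x * ln (x / q)) x"
      by (intro continuous_intros) auto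
    then show ?thesis
      by (rule continuous_at_imp_continuous_at_within)
  next
    case True
    \<comment> \<open>The substitution \<open>x \<mapsto> 1 / x\<close> reduces the limit at \<open>0\<close> to that of \<open>ln x / x\<close> at infinity.\<close>
    have "((\<lambda>x. - (ln x / x) - ln q * inverse x) \<longlongrightarrow> - 0 - ln q * 0) at_top"
      by (intro tendsto_intros ln_x_over_x_tendsto_0 tendsto_inverse_0_at_top filterlim_ident)
    moreover have "\<forall>\<^sub>F x in at_top. - (ln x / x) - ln q * inverse x = inverse x * ln (inverse x / q)"
      using eventually_gt_at_top[of 0]
    proof eventually_elim
      case (elim x)
      then have "ln (inverse x / q) = - ln x - ln q"
        using assms by (simp add: ln_div ln_inverse)
      then show ?case
        by (simp only:) (simp add: divide_inverse right_diff_distrib mult.commute)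
    qed
    ultimately have "((\<lambda>x. inverse x * ln (inverse x / q)) \<longlongrightarrow> - 0 - ln q * 0) at_top"
      by (rule Lim_transform_eventually)
    then have "((\<lambda>x. x * ln (x / q)) \<longlongrightarrow> 0) (at_right 0)"
      by (simp add: filterlim_at_right_to_top)
    then show ?thesis
      using True by (simp add: continuous_within at_within_Ici_at_right)
  qed
  then show ?thesis
    by (simp add: continuous_on_eq_continuous_within)
qed

section \<open>Complementary potentials\<close>

text \<open>These are the Karush-Kuhn-Tucker conditions for minimizing \<open>rel_entropy (X_push E Q) \<mu>\<close> over the
  \<open>Q\<close> with \<open>Y_push E Q = \<nu>\<close>: the derivative in the entry \<open>(i, j)\<close> is \<open>1 - v $ i\<close>, and \<open>1 + w $ j\<close> is
  the multiplier of the constraint on the column \<open>j\<close>. Stated with both potentials they are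
  symmetric in the two sides.\<close>

definition complementary ::
  "real ^ 'm \<Rightarrow> real ^ 'n \<Rightarrow> ('m \<times> 'n) set \<Rightarrow> real ^ 'm \<Rightarrow> real ^ 'n \<Rightarrow> real ^ 'n ^ 'm \<Rightarrow> bool" where
  "complementary \<mu> \<nu> E v w Q \<longleftrightarrow>
     Q \<in> dist_on E \<and> (\<forall>i. X_push E Q $ i = \<mu> $ i * exp (- v $ i)) \<and> Y_push E Q = \<nu> \<and>
     (\<forall>(i, j)\<in>E. v $ i + w $ j \<le> 0) \<and> (\<forall>i j. 0 < Q $ i $ j \<longrightarrow> v $ i + w $ j = 0)"

lemma sum_X_push:
  assumes "Q \<in> dist_on E"
  shows "(\<Sum>i\<in>UNIV. X_push E Q $ i * a i) = (\<Sum>i\<in>UNIV. \<Sum>j\<in>UNIV. Q $ i $ j * a i)"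
  by (simp add: X_push_eq_row_sum[OF assms] sum_distrib_right)

lemma sum_Y_push:
  assumes "Q \<in> dist_on E"
  shows "(\<Sum>j\<in>UNIV. Y_push E Q $ j * b j) = (\<Sum>i\<in>UNIV. \<Sum>j\<in>UNIV. Q $ i $ j * b j)"
  by (subst sum.swap) (simp add: Y_push_eq_column_sum[OF assms] sum_distrib_right)

lemma X_push_nonneg: "Q \<in> dist_on E \<Longrightarrow> 0 \<le> X_push E Q $ i"
  by (auto simp: X_push_eq_row_sum dist_on_iff intro!: sum_nonneg)

lemma sum_X_push_eq_1: "Q \<in> dist_on E \<Longrightarrow> (\<Sum>i\<in>UNIV. X_push E Q $ i) = 1"
  by (simp add: X_push_eq_row_sum) (simp add: dist_on_iff)

text \<open>The excess of \<open>H(r|\<mu>)\<close> over \<open>H(r|x)\<close>, where \<open>r\<close> and \<open>x\<close> are the first marginals of \<open>R\<close> and \<open>Q\<close>, is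
  linear in \<open>r\<close>, namely \<open>- \<Sum>r\<^sub>i v\<^sub>i\<close>. On \<open>E\<close> one has \<open>- v\<^sub>i \<ge> w\<^sub>j\<close>, so it is at least
  \<open>\<Sum>\<nu>\<^sub>j w\<^sub>j\<close>, a quantity independent of \<open>R\<close> and attained by \<open>Q\<close>.\<close>

lemma complementary_pythagoras:
  assumes c: "complementary \<mu> \<nu> E v w Q" and \<mu>: "\<And>i. 0 < \<mu> $ i"
    and R: "R \<in> dist_on E" "Y_push E R = \<nu>"
  shows "rel_entropy (X_push E R) (X_push E Q) + rel_entropy (X_push E Q) \<mu>
           \<le> rel_entropy (X_push E R) \<mu>"
proof -
  let ?x = "X_push E Q" and ?r = "X_push E R"
  have Q: "Q \<in> dist_on E" "Y_push E Q = \<nu>" and x: "?x $ i = \<mu> $ i * exp (- v $ i)"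
    and le: "(i, j) \<in> E \<Longrightarrow> v $ i + w $ j \<le> 0" and eq: "0 < Q $ i $ j \<Longrightarrow> v $ i + w $ j = 0" for i j
    using c unfolding complementary_def by auto
  have ln_x: "ln (?x $ i / \<mu> $ i) = - v $ i" for i
    using \<mu>[of i] by (simp add: x)
  have "rel_entropy ?x \<mu> = (\<Sum>i\<in>UNIV. \<Sum>j\<in>UNIV. Q $ i $ j * - v $ i)"
    unfolding rel_entropy_def ln_x by (rule sum_X_push[OF Q(1)])
  also have "\<dots> = (\<Sum>i\<in>UNIV. \<Sum>j\<in>UNIV. Q $ i $ j * w $ j)"
  proof (intro sum.cong refl)
    fix i j
    have "Q $ i $ j = 0 \<or> 0 < Q $ i $ j"
      using Q by (auto simp: dist_on_iff less_le)
    then show "Q $ i $ j * - v $ i = Q $ i $ j * w $ j"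
      using eq[of i j] by (auto simp: add_eq_0_iff)
  qed
  also have "\<dots> = (\<Sum>i\<in>UNIV. \<Sum>j\<in>UNIV. R $ i $ j * w $ j)"
    using sum_Y_push[OF Q(1), of "\<lambda>j. w $ j"] sum_Y_push[OF R(1), of "\<lambda>j. w $ j"] Q R by simp
  also have "\<dots> \<le> (\<Sum>i\<in>UNIV. \<Sum>j\<in>UNIV. R $ i $ j * - v $ i)"
  proof (intro sum_mono)
    fix i j
    show "R $ i $ j * w $ j \<le> R $ i $ j * - v $ i"
    proof (cases "(i, j) \<in> E")
      case True
      then show ?thesis
        using R(1) le[of i j] by (intro mult_left_mono) (auto simp: dist_on_iff)
    qed (use R(1) in \<open>simp add: dist_on_iff\<close>)
  qed
  also have "\<dots> = (\<Sum>i\<in>UNIV. ?r $ i * - v $ i)"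
    by (rule sum_X_push[OF R(1), symmetric])
  finally have "rel_entropy ?x \<mu> \<le> (\<Sum>i\<in>UNIV. ?r $ i * - v $ i)" .
  moreover have "rel_entropy ?r \<mu> = rel_entropy ?r ?x + (\<Sum>i\<in>UNIV. ?r $ i * - v $ i)"
  proof -
    have "?r $ i * ln (?r $ i / \<mu> $ i) = ?r $ i * ln (?r $ i / ?x $ i) + ?r $ i * - v $ i" for i
    proof (cases "?r $ i = 0")
      case False
      then have "ln (?r $ i / \<mu> $ i) = ln (?r $ i / ?x $ i) + - v $ i"
        using X_push_nonneg[OF R(1), of i] \<mu>[of i] by (simp add: x ln_div ln_mult)
      then show ?thesis
        by (simp only: distrib_left)
    qed simp
    then show ?thesis
      unfolding rel_entropy_def by (simp only: sum.distrib)
  qed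
  ultimately show ?thesis
    by simp
qed

lemma complementary_imp_mu_star:
  assumes c: "complementary \<mu> \<nu> E v w Q" and \<mu>: "\<And>i. 0 < \<mu> $ i"
  shows "mu_star \<mu> \<nu> E = X_push E Q"
  unfolding mu_star_def
proof (rule the_equality)
  have Q: "Q \<in> dist_on E" "Y_push E Q = \<nu>" and x: "0 < X_push E Q $ i" for i
    using c \<mu>[of i] unfolding complementary_def by auto
  have gap: "rel_entropy (X_push E R) (X_push E Q) \<le> rel_entropy (X_push E R) \<mu> - rel_entropy (X_push E Q) \<mu>"
    if "R \<in> dist_on E" "Y_push E R = \<nu>" for R
    using complementary_pythagoras[OF c \<mu> that] by simp
  have "rel_entropy (X_push E Q) \<mu> \<le> rel_entropy (X_push E R) \<mu>"
    if "R \<in> dist_on E" "Y_push E R = \<nu>" for R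
    using gap[OF that] rel_entropy_nonneg[of "X_push E R" "X_push E Q"] x Q that
    by (force simp: X_push_nonneg sum_X_push_eq_1)
  with Q show "is_arg_min (\<lambda>x. rel_entropy x \<mu>) (\<lambda>x. \<exists>Q\<in>dist_on E. X_push E Q = x \<and> Y_push E Q = \<nu>)
      (X_push E Q)"
    by (auto simp: is_arg_min_linorder)
  fix m
  assume "is_arg_min (\<lambda>x. rel_entropy x \<mu>) (\<lambda>x. \<exists>Q\<in>dist_on E. X_push E Q = x \<and> Y_push E Q = \<nu>) m"
  then obtain R where R: "R \<in> dist_on E" "Y_push E R = \<nu>" "m = X_push E R"
    and "rel_entropy m \<mu> \<le> rel_entropy (X_push E Q) \<mu>"
    using Q by (auto simp: is_arg_min_linorder)
  with gap[OF R(1,2)] have "rel_entropy m (X_push E Q) \<le> 0"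
    by simp
  then show "m = X_push E Q"
    using x Q R by (intro rel_entropy_nonpos_imp_eq) (auto simp: X_push_nonneg sum_X_push_eq_1)
qed

lemma complementary_imp_v_star:
  assumes c: "complementary \<mu> \<nu> E v w Q" and \<mu>: "\<And>i. 0 < \<mu> $ i"
  shows "v_star \<mu> \<nu> E = v"
proof -
  have "ln (\<mu> $ i / X_push E Q $ i) = v $ i" for i
    using c \<mu>[of i] unfolding complementary_def by (simp add: ln_div ln_mult)
  then show ?thesis
    unfolding v_star_def complementary_imp_mu_star[OF assms] by (simp add: vec_eq_iff)
qed

text \<open>On the support of \<open>Q\<close> the factor \<open>exp (v\<^sub>i)\<close> equals \<open>exp (- w\<^sub>j)\<close>. As a scaling of rows it changes
  the first marginal from \<open>\<mu>\<^sub>i exp (- v\<^sub>i)\<close> to \<open>\<mu>\<^sub>i\<close>, as a scaling of columns the second one from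
  \<open>\<nu>\<^sub>j\<close> to \<open>\<nu>\<^sub>j exp (- w\<^sub>j)\<close>.\<close>

lemma complementary_converse:
  assumes c: "complementary \<mu> \<nu> E v w Q" and \<mu>: "(\<Sum>i\<in>UNIV. \<mu> $ i) = 1"
  shows "complementary \<nu> \<mu> (E\<inverse>) w v (transpose (\<chi> i j. exp (v $ i) * Q $ i $ j))"
proof -
  define P where "P = (\<chi> i j. exp (v $ i) * Q $ i $ j)"
  have Q: "Q \<in> dist_on E" "Y_push E Q = \<nu>" and x: "X_push E Q $ i = \<mu> $ i * exp (- v $ i)"
    and le: "(i, j) \<in> E \<Longrightarrow> v $ i + w $ j \<le> 0" and eq: "0 < Q $ i $ j \<Longrightarrow> v $ i + w $ j = 0" for i j
    using c unfolding complementary_def by auto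
  have rows: "(\<Sum>j\<in>UNIV. P $ i $ j) = \<mu> $ i" for i
  proof -
    have "(\<Sum>j\<in>UNIV. P $ i $ j) = exp (v $ i) * X_push E Q $ i"
      by (simp add: P_def X_push_eq_row_sum[OF Q(1)] sum_distrib_left)
    then show ?thesis
      by (simp add: x flip: exp_add)
  qed
  then have P: "P \<in> dist_on E"
    using Q(1) \<mu> unfolding dist_on_iff by (auto simp: P_def)
  have P_eq: "P $ i $ j = exp (- w $ j) * Q $ i $ j" for i j
  proof -
    have "Q $ i $ j = 0 \<or> 0 < Q $ i $ j"
      using Q by (auto simp: dist_on_iff less_le)
    then show ?thesis
      using eq[of i j] by (auto simp: P_def add_eq_0_iff2)
  qed
  have "Y_push E P $ j = \<nu> $ j * exp (- w $ j)" for j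
    using Q by (simp add: Y_push_eq_column_sum[OF P] P_eq sum_distrib_left[symmetric]
        Y_push_eq_column_sum[OF Q(1), symmetric])
  moreover have "X_push E P = \<mu>"
    by (simp add: vec_eq_iff X_push_eq_row_sum[OF P] rows)
  moreover have "0 < Q $ i $ j" if "0 < transpose P $ j $ i" for i j
    using that by (simp add: P_def transpose_def zero_less_mult_iff)
  moreover have "transpose P \<in> dist_on (E\<inverse>)"
    using P by (simp add: transpose_in_dist_on_converse)
  ultimately show ?thesis
    unfolding complementary_def P_def[symmetric] push_converse_transpose
    using le eq by (auto simp: add.commute)
qed

lemma complementary_imp_w_star:
  assumes "complementary \<mu> \<nu> E v w Q" "(\<Sum>i\<in>UNIV. \<mu> $ i) = 1" "\<And>j. 0 < \<nu> $ j"
  shows "w_star \<mu> \<nu> E = w"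
  using complementary_imp_v_star[OF complementary_converse[OF assms(1,2)] assms(3)]
  unfolding w_star_def v_star_def nu_star_eq_mu_star_converse .

lemma compact_dist_on_Y_push: "compact {Q \<in> dist_on E. Y_push E Q = \<nu>}"
proof -
  have "{Q \<in> dist_on E. Y_push E Q = \<nu>} =
    (\<Inter>i. \<Inter>j. {Q. 0 \<le> Q $ i $ j}) \<inter> (\<Inter>(i, j)\<in>-E. {Q. Q $ i $ j = 0}) \<inter>
    {Q. (\<Sum>i\<in>UNIV. \<Sum>j\<in>UNIV. Q $ i $ j) = 1} \<inter>
    (\<Inter>j. {Q. (\<Sum>i | (i, j) \<in> E. Q $ i $ j) = \<nu> $ j})"
    by (auto simp: dist_on_iff Y_push_def vec_eq_iff)
  moreover have "closed \<dots>"
    by (intro closed_Int closed_INT ballI)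
      (auto intro!: closed_Collect_le closed_Collect_eq continuous_intros)
  moreover have "bounded {Q \<in> dist_on E. Y_push E Q = \<nu>}"
  proof (rule boundedI)
    fix Q assume "Q \<in> {Q \<in> dist_on E. Y_push E Q = \<nu>}"
    then have Q: "\<And>i j. 0 \<le> Q $ i $ j" "(\<Sum>i\<in>UNIV. \<Sum>j\<in>UNIV. Q $ i $ j) = 1"
      by (auto simp: dist_on_iff)
    have "norm Q \<le> (\<Sum>i\<in>UNIV. norm (Q $ i))"
      unfolding norm_vec_def by (rule L2_set_le_sum) simp
    also have "\<dots> \<le> (\<Sum>i\<in>UNIV. \<Sum>j\<in>UNIV. \<bar>Q $ i $ j\<bar>)"
      by (intro sum_mono norm_le_l1_cart)
    also have "\<dots> = 1"
      using Q by simp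
    finally show "norm Q \<le> 1" .
  qed
  ultimately show ?thesis
    by (simp add: compact_eq_bounded_closed)
qed

lemma exists_minimal_dist_on:
  assumes \<nu>: "\<nu> \<in> prob_simplex" and \<mu>: "\<And>i. 0 < \<mu> $ i"
    and cover: "\<And>j. \<exists>i. (i, j) \<in> E"
  obtains Q where "Q \<in> dist_on E" "Y_push E Q = \<nu>"
    and "\<And>R. R \<in> dist_on E \<Longrightarrow> Y_push E R = \<nu> \<Longrightarrow>
           rel_entropy (X_push E Q) \<mu> \<le> rel_entropy (X_push E R) \<mu>"
proof -
  let ?K = "{Q \<in> dist_on E. Y_push E Q = \<nu>}"
  \<comment> \<open>A feasible point: each \<open>j\<close> receives all its mass from one chosen neighbour.\<close>
  obtain \<sigma> where \<sigma>: "\<And>j. (\<sigma> j, j) \<in> E"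
    using cover by metis
  define R where "R = (\<chi> i j. if i = \<sigma> j then \<nu> $ j else 0)"
  have cols: "(\<Sum>i\<in>UNIV. R $ i $ j) = \<nu> $ j" for j
    by (simp add: R_def)
  have "(\<Sum>i\<in>UNIV. \<Sum>j\<in>UNIV. R $ i $ j) = 1"
    using \<nu> by (subst sum.swap) (simp add: cols prob_simplex_def)
  then have "R \<in> dist_on E"
    using \<nu> \<sigma> unfolding dist_on_iff by (auto simp: R_def prob_simplex_def)
  moreover from this have "Y_push E R = \<nu>"
    by (simp add: vec_eq_iff Y_push_eq_column_sum cols)
  ultimately have nonempty: "?K \<noteq> {}"
    by auto
  have cont: "continuous_on ?K (\<lambda>Q. rel_entropy (X_push E Q) \<mu>)"
    unfolding rel_entropy_def
  proof (intro continuous_on_sum continuous_on_compose2[OF continuous_on_mult_ln_ratio])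
    show "continuous_on ?K (\<lambda>Q. X_push E Q $ i)" for i
      unfolding X_push_def vec_lambda_beta by (intro continuous_intros)
  qed (use \<mu> in \<open>auto simp: X_push_nonneg\<close>)
  obtain Q where "Q \<in> ?K"
    and "\<forall>R\<in>?K. rel_entropy (X_push E Q) \<mu> \<le> rel_entropy (X_push E R) \<mu>"
    using continuous_attains_inf[OF compact_dist_on_Y_push nonempty cont] by blast
  with that show thesis
    by auto
qed

text \<open>If \<open>j\<close> receives mass from \<open>a\<close>, a small amount \<open>\<epsilon>\<close> of it can be taken from another neighbour \<open>b\<close>
  instead. By convexity, minimality forbids that this lowers the larger of the two ratios
  \<open>x / \<mu>\<close> while keeping it the larger one; the claim is the limit \<open>\<epsilon> \<rightarrow> 0\<close>.\<close>

lemma minimal_imp_ratio_le: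
  fixes \<mu> :: "real ^ 'm" and E :: "('m \<times> 'n::finite) set"
  assumes \<mu>: "\<And>i. 0 < \<mu> $ i" and Q: "Q \<in> dist_on E"
    and min: "\<And>R. R \<in> dist_on E \<Longrightarrow> Y_push E R = Y_push E Q \<Longrightarrow>
           rel_entropy (X_push E Q) \<mu> \<le> rel_entropy (X_push E R) \<mu>"
    and pos: "0 < Q $ a $ j" and edge: "(b, j) \<in> E"
  shows "X_push E Q $ a / \<mu> $ a \<le> X_push E Q $ b / \<mu> $ b"
proof (cases "a = b")
  case False
  let ?x = "X_push E Q"
  have entry_le: "Q $ a $ j \<le> ?x $ a"
    unfolding X_push_eq_row_sum[OF Q] using Q by (intro member_le_sum) (auto simp: dist_on_iff)
  have aj: "(a, j) \<in> E"
    using Q pos by (force simp: dist_on_iff)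
  have shift: "(?x $ a - \<epsilon>) / \<mu> $ a \<le> (?x $ b + \<epsilon>) / \<mu> $ b" if \<epsilon>: "0 < \<epsilon>" "\<epsilon> < Q $ a $ j" for \<epsilon>
  proof -
    define D :: "real ^ 'n ^ 'm" where
      "D = (\<chi> i k. if k = j then (if i = a then - \<epsilon> else 0) + (if i = b then \<epsilon> else 0) else 0)"
    define y where "y = (\<chi> i. ?x $ i + (if i = a then - \<epsilon> else 0) + (if i = b then \<epsilon> else 0))"
    have rows: "(\<Sum>k\<in>UNIV. D $ i $ k) = (if i = a then - \<epsilon> else 0) + (if i = b then \<epsilon> else 0)" for i
      by (simp add: D_def)
    have cols: "(\<Sum>i\<in>UNIV. D $ i $ k) = 0" for k
      by (cases "k = j") (simp_all add: D_def sum.distrib)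
    have R: "Q + D \<in> dist_on E"
      unfolding dist_on_iff
    proof (intro conjI allI impI)
      show "0 \<le> (Q + D) $ i $ k" for i k
        using Q \<epsilon> False by (auto simp: D_def dist_on_iff)
      show "(Q + D) $ i $ k = 0" if "(i, k) \<notin> E" for i k
        using that Q aj edge by (auto simp: D_def dist_on_iff)
      show "(\<Sum>i\<in>UNIV. \<Sum>k\<in>UNIV. (Q + D) $ i $ k) = 1"
        using Q by (simp add: sum.distrib rows) (simp add: dist_on_iff)
    qed
    have "Y_push E (Q + D) = Y_push E Q"
      by (simp add: vec_eq_iff Y_push_eq_column_sum[OF R] Y_push_eq_column_sum[OF Q] sum.distrib cols)
    moreover have "X_push E (Q + D) = y"
      by (simp add: vec_eq_iff X_push_eq_row_sum[OF R] X_push_eq_row_sum[OF Q] sum.distrib rows y_def)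
    ultimately have le: "rel_entropy ?x \<mu> \<le> rel_entropy y \<mu>"
      using min[OF R] by simp
    let ?h = "\<lambda>z i. z $ i * ln (z $ i / \<mu> $ i)"
    have split: "rel_entropy z \<mu> = ?h z a + ?h z b + (\<Sum>i\<in>UNIV - {a} - {b}. ?h z i)" for z
      unfolding rel_entropy_def using False by (simp add: sum.remove[of _ a] sum.remove[of _ b])
    have "(\<Sum>i\<in>UNIV - {a} - {b}. ?h ?x i) = (\<Sum>i\<in>UNIV - {a} - {b}. ?h y i)"
      by (intro sum.cong) (auto simp: y_def)
    with le have le2: "?h ?x a + ?h ?x b \<le> ?h y a + ?h y b"
      unfolding split by simp
    have y: "y $ a = ?x $ a - \<epsilon>" "y $ b = ?x $ b + \<epsilon>"
      using False by (auto simp: y_def)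
    have y_pos: "0 < y $ a" "0 < y $ b"
      unfolding y using \<epsilon> entry_le X_push_nonneg[OF Q, of b] by auto
    \<comment> \<open>The tangents are taken at the shifted point: \<open>?x $ b\<close> may vanish, \<open>y $ b\<close> does not.\<close>
    have "?h y a + (ln (y $ a / \<mu> $ a) + 1) * \<epsilon> \<le> ?h ?x a"
      using mult_ln_tangent[OF y_pos(1) X_push_nonneg[OF Q, of a] \<mu>[of a]] by (simp add: y)
    moreover have "?h y b - (ln (y $ b / \<mu> $ b) + 1) * \<epsilon> \<le> ?h ?x b"
      using mult_ln_tangent[OF y_pos(2) X_push_nonneg[OF Q, of b] \<mu>[of b]] by (simp add: y)
    ultimately have "\<epsilon> * ln (y $ a / \<mu> $ a) \<le> \<epsilon> * ln (y $ b / \<mu> $ b)"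
      using le2 by (simp add: algebra_simps)
    then have "ln (y $ a / \<mu> $ a) \<le> ln (y $ b / \<mu> $ b)"
      using \<epsilon> by simp
    then have "y $ a / \<mu> $ a \<le> y $ b / \<mu> $ b"
      using y_pos \<mu> by (subst (asm) ln_le_cancel_iff) auto
    then show ?thesis
      by (simp add: y)
  qed
  show ?thesis
  proof (rule tendsto_le[of "at_right 0"])
    show "((\<lambda>\<epsilon>. (?x $ b + \<epsilon>) / \<mu> $ b) \<longlongrightarrow> ?x $ b / \<mu> $ b) (at_right 0)"
      using \<mu>[of b] by (auto intro!: tendsto_eq_intros)
    show "((\<lambda>\<epsilon>. (?x $ a - \<epsilon>) / \<mu> $ a) \<longlongrightarrow> ?x $ a / \<mu> $ a) (at_right 0)"
      using \<mu>[of a] by (auto intro!: tendsto_eq_intros)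
    show "\<forall>\<^sub>F \<epsilon> in at_right 0. (?x $ a - \<epsilon>) / \<mu> $ a \<le> (?x $ b + \<epsilon>) / \<mu> $ b"
      using shift pos by (auto simp: eventually_at_right_field)
  qed simp
qed simp

text \<open>The exchange condition says that the neighbours of \<open>j\<close> which supply mass to it all have the maximal
  \<open>v\<close> among its neighbours; minus this maximum is therefore a complementary potential. It also
  gives \<open>\<mu>\<^sup>* > 0\<close>, without which \<open>v\<close> would be meaningless: every \<open>i\<close> has a neighbour \<open>j\<close>, which
  is supplied by some \<open>a\<close>, and the ratio \<open>x / \<mu>\<close> at \<open>i\<close> is at least the positive ratio at \<open>a\<close>.\<close>

lemma exists_complementary:
  fixes \<mu> :: "real ^ 'm" and \<nu> :: "real ^ 'n"
  assumes \<nu>: "\<nu> \<in> prob_simplex" and \<mu>_pos: "\<And>i. 0 < \<mu> $ i" and \<nu>_pos: "\<And>j. 0 < \<nu> $ j"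
    and coverX: "\<And>i. \<exists>j. (i, j) \<in> E" and coverY: "\<And>j. \<exists>i. (i, j) \<in> E"
  obtains v w Q where "complementary \<mu> \<nu> E v w Q"
proof -
  obtain Q where Q: "Q \<in> dist_on E" "Y_push E Q = \<nu>"
    and min: "\<And>R. R \<in> dist_on E \<Longrightarrow> Y_push E R = \<nu> \<Longrightarrow>
           rel_entropy (X_push E Q) \<mu> \<le> rel_entropy (X_push E R) \<mu>"
    using exists_minimal_dist_on[OF \<nu> \<mu>_pos coverY] by blast
  let ?x = "X_push E Q"
  have ratio_le: "?x $ a / \<mu> $ a \<le> ?x $ b / \<mu> $ b" if "0 < Q $ a $ j" "(b, j) \<in> E" for a b j
    using minimal_imp_ratio_le[OF \<mu>_pos Q(1) _ that] min Q(2) by simp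
  have supplier: "\<exists>a. 0 < Q $ a $ j" for j
  proof (rule ccontr)
    assume "\<nexists>a. 0 < Q $ a $ j"
    then have "Y_push E Q $ j \<le> 0"
      unfolding Y_push_eq_column_sum[OF Q(1)] by (intro sum_nonpos) (simp add: not_less)
    then show False
      using Q \<nu>_pos[of j] by simp
  qed
  have x_pos: "0 < ?x $ i" for i
  proof -
    obtain j a where j: "(i, j) \<in> E" and a: "0 < Q $ a $ j"
      using coverX supplier by metis
    have "Q $ a $ j \<le> ?x $ a"
      unfolding X_push_eq_row_sum[OF Q(1)] using Q(1) by (intro member_le_sum) (auto simp: dist_on_iff)
    with a have "0 < ?x $ a / \<mu> $ a"
      using \<mu>_pos[of a] by simp
    also have "\<dots> \<le> ?x $ i / \<mu> $ i"
      using ratio_le a j by simp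
    finally show ?thesis
      using \<mu>_pos[of i] by (simp add: zero_less_divide_iff)
  qed
  define v where "v = (\<chi> i. ln (\<mu> $ i / ?x $ i))"
  define w where "w = (\<chi> j. - Max {v $ i | i. (i, j) \<in> E})"
  have fin: "finite {v $ i | i. (i, j) \<in> E}" for j
    by simp
  have le: "v $ i + w $ j \<le> 0" if "(i, j) \<in> E" for i j
  proof -
    have "v $ i \<le> Max {v $ i | i. (i, j) \<in> E}"
      using that by (intro Max_ge fin) blast
    then show ?thesis
      by (simp add: w_def)
  qed
  have "v $ a + w $ j = 0" if a: "0 < Q $ a $ j" for a j
  proof -
    have "v $ i \<le> v $ a" if "(i, j) \<in> E" for i
    proof -
      have "ln (?x $ a / \<mu> $ a) \<le> ln (?x $ i / \<mu> $ i)"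
        using ratio_le[OF a that] \<mu>_pos x_pos by (subst ln_le_cancel_iff) auto
      then show ?thesis
        using \<mu>_pos[of a] \<mu>_pos[of i] x_pos[of a] x_pos[of i] by (simp add: v_def ln_div)
    qed
    moreover have "(a, j) \<in> E"
      using Q(1) a by (force simp: dist_on_iff)
    ultimately have "Max {v $ i | i. (i, j) \<in> E} = v $ a"
      by (intro Max_eqI) auto
    then show ?thesis
      by (simp add: w_def)
  qed
  moreover have "?x $ i = \<mu> $ i * exp (- v $ i)" for i
    using \<mu>_pos[of i] x_pos[of i] by (simp add: v_def exp_minus)
  ultimately have "complementary \<mu> \<nu> E v w Q"
    unfolding complementary_def using Q le by auto
  then show thesis
    by (rule that)
qed

section \<open>Consequences for the dual problem\<close>

text \<open>The sum is the rate at which \<open>f \<bullet> \<mu>\<close> grows under the velocity \<open>v\<close>. As \<open>v\<^sub>i = ln (\<mu>\<^sub>i / x\<^sub>i)\<close> for the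
  first marginal \<open>x\<close> of \<open>Q\<close>, it is the relative entropy \<open>H(\<mu>|x)\<close>.\<close>

lemma complementary_objective_rate:
  fixes \<mu> :: "real ^ 'm"
  assumes c: "complementary \<mu> \<nu> E v w Q" and \<mu>: "\<And>i. 0 < \<mu> $ i" "(\<Sum>i\<in>UNIV. \<mu> $ i) = 1"
  shows "0 \<le> (\<Sum>i\<in>UNIV. \<mu> $ i * v $ i)"
    and "(\<Sum>i\<in>UNIV. \<mu> $ i * v $ i) \<le> 0 \<Longrightarrow> v = 0"
proof -
  have Q: "Q \<in> dist_on E" and x: "X_push E Q $ i = \<mu> $ i * exp (- v $ i)" for i
    using c unfolding complementary_def by auto
  have ratio: "ln (\<mu> $ i / X_push E Q $ i) = v $ i" for i
    using \<mu>(1)[of i] by (simp add: x ln_div ln_mult)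
  have rate: "(\<Sum>i\<in>UNIV. \<mu> $ i * v $ i) = rel_entropy \<mu> (X_push E Q)"
    unfolding rel_entropy_def ratio ..
  have nonneg: "0 \<le> \<mu> $ i" and pos: "0 < X_push E Q $ i" for i
    using \<mu>(1)[of i] by (simp_all add: x)
  have mass: "(\<Sum>i\<in>UNIV. \<mu> $ i) = (\<Sum>i\<in>UNIV. X_push E Q $ i)"
    using \<mu>(2) sum_X_push_eq_1[OF Q] by simp
  show "0 \<le> (\<Sum>i\<in>UNIV. \<mu> $ i * v $ i)"
    unfolding rate by (rule rel_entropy_nonneg[OF nonneg pos mass])
  assume "(\<Sum>i\<in>UNIV. \<mu> $ i * v $ i) \<le> 0"
  then have eq: "\<mu> = X_push E Q"
    unfolding rate by (rule rel_entropy_nonpos_imp_eq[OF nonneg pos mass])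
  have "v $ i = 0" for i
    using ratio[of i] \<mu>(1)[of i] by (simp flip: eq)
  then show "v = 0"
    by (simp add: vec_eq_iff)
qed

text \<open>The average of \<open>v\<^sub>i + w\<^sub>j\<close> over the product measure \<open>\<mu>\<^sub>i \<nu>\<^sub>j\<close> is the sum of the two rates, each of
  which is nonnegative.\<close>

lemma complementary_eq_0_if_nonpos:
  fixes \<mu> :: "real ^ 'm" and \<nu> :: "real ^ 'n"
  assumes c: "complementary \<mu> \<nu> E v w Q"
    and \<mu>: "\<And>i. 0 < \<mu> $ i" "(\<Sum>i\<in>UNIV. \<mu> $ i) = 1"
    and \<nu>: "\<And>j. 0 < \<nu> $ j" "(\<Sum>j\<in>UNIV. \<nu> $ j) = 1"
    and nonpos: "\<And>i j. v $ i + w $ j \<le> 0"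
  shows "v = 0" and "w = 0"
proof -
  note c' = complementary_converse[OF c \<mu>(2)]
  have "(\<Sum>i\<in>UNIV. \<mu> $ i * v $ i) + (\<Sum>j\<in>UNIV. \<nu> $ j * w $ j)
      = (\<Sum>i\<in>UNIV. \<mu> $ i * v $ i) * (\<Sum>j\<in>UNIV. \<nu> $ j) + (\<Sum>i\<in>UNIV. \<mu> $ i) * (\<Sum>j\<in>UNIV. \<nu> $ j * w $ j)"
    using \<mu>(2) \<nu>(2) by simp
  also have "\<dots> = (\<Sum>i\<in>UNIV. \<Sum>j\<in>UNIV. \<mu> $ i * \<nu> $ j * (v $ i + w $ j))"
    unfolding sum_product by (simp add: sum.distrib[symmetric] algebra_simps)
  also have "\<dots> \<le> 0"
    using nonpos \<mu>(1) \<nu>(1) by (intro sum_nonpos mult_nonneg_nonpos) (auto simp: less_imp_le)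
  finally have "(\<Sum>i\<in>UNIV. \<mu> $ i * v $ i) + (\<Sum>j\<in>UNIV. \<nu> $ j * w $ j) \<le> 0" .
  with complementary_objective_rate(1)[OF c \<mu>] complementary_objective_rate(1)[OF c' \<nu>]
  show "v = 0" "w = 0"
    by (auto intro: complementary_objective_rate(2)[OF c \<mu>] complementary_objective_rate(2)[OF c' \<nu>])
qed

lemma tight_coupling_imp_optimal:
  fixes C :: "real ^ 'n ^ 'm"
  assumes Q: "Q \<in> dist_on E" "X_push E Q = \<mu>" "Y_push E Q = \<nu>"
    and feasible: "(f, g) \<in> dual_polytope C"
    and tight: "\<And>i j. (i, j) \<in> E \<Longrightarrow> f $ i + g $ j = C $ i $ j"
  shows "is_arg_max (\<lambda>(x, y). x \<bullet> \<mu> + y \<bullet> \<nu>) (\<lambda>(x, y). \<forall>i j. x $ i + y $ j \<le> C $ i $ j) (f, g)"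
proof -
  have objective: "x \<bullet> \<mu> + y \<bullet> \<nu> = (\<Sum>i\<in>UNIV. \<Sum>j\<in>UNIV. Q $ i $ j * (x $ i + y $ j))" for x y
    using sum_X_push[OF Q(1), of "\<lambda>i. x $ i"] sum_Y_push[OF Q(1), of "\<lambda>j. y $ j"]
    unfolding Q(2,3) by (simp add: inner_vec_def sum.distrib distrib_left mult.commute)
  have "x \<bullet> \<mu> + y \<bullet> \<nu> \<le> f \<bullet> \<mu> + g \<bullet> \<nu>" if "\<forall>i j. x $ i + y $ j \<le> C $ i $ j" for x y
    unfolding objective
  proof (intro sum_mono)
    fix i j
    show "Q $ i $ j * (x $ i + y $ j) \<le> Q $ i $ j * (f $ i + g $ j)"
      using that Q(1) tight[of i j]
      by (cases "(i, j) \<in> E") (auto simp: dist_on_iff intro!: mult_left_mono)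
  qed
  with feasible show ?thesis
    by (auto simp: is_arg_max_linorder dual_polytope_def)
qed

lemma pareto_frontier_tight_row:
  fixes C :: "real ^ 'n ^ 'm"
  assumes "(f, g) \<in> pareto_frontier C"
  shows "\<exists>j. f $ i + g $ j = C $ i $ j"
proof -
  have feasible: "f $ i + g $ j \<le> C $ i $ j" for i j
    using assms by (auto simp: pareto_frontier_def dual_polytope_def)
  define \<delta> where "\<delta> = Min (range (\<lambda>j. C $ i $ j - g $ j - f $ i))"
  have "\<delta> \<in> range (\<lambda>j. C $ i $ j - g $ j - f $ i)"
    unfolding \<delta>_def by (intro Min_in) auto
  then obtain j where j: "\<delta> = C $ i $ j - g $ j - f $ i"
    by auto
  have nonneg: "0 \<le> \<delta>"
    using feasible[of i j] by (simp add: j)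
  have least: "\<delta> \<le> C $ i $ k - g $ k - f $ i" for k
    unfolding \<delta>_def by (intro Min_le) auto
  \<comment> \<open>Raising \<open>f $ i\<close> by the smallest slack in its row stays feasible, so that slack is \<open>0\<close>.\<close>
  define f' where "f' = (\<chi> k. if k = i then f $ i + \<delta> else f $ k)"
  have "f' $ k + g $ l \<le> C $ k $ l" for k l
    using feasible[of k l] least[of l] by (auto simp: f'_def)
  then have "(f', g) \<in> dual_polytope C"
    by (simp add: dual_polytope_def)
  moreover have "f $ k \<le> f' $ k" for k
    using nonneg by (simp add: f'_def)
  ultimately have "f' = f"
    using assms by (auto simp: pareto_frontier_def)
  then have "f' $ i = f $ i"
    by simp
  then show ?thesis
    using j by (intro exI[of _ j]) (simp add: f'_def)
qed

lemma pareto_frontier_transpose: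
  assumes "(f, g) \<in> pareto_frontier C"
  shows "(g, f) \<in> pareto_frontier (transpose C)"
proof -
  have "(g', f') \<in> dual_polytope (transpose C) \<longleftrightarrow> (f', g') \<in> dual_polytope C" for f' g'
    by (auto simp: dual_polytope_def transpose_def add.commute)
  with assms show ?thesis
    by (simp add: pareto_frontier_def)
qed

lemma pareto_frontier_tight_column:
  assumes "(f, g) \<in> pareto_frontier C"
  shows "\<exists>i. f $ i + g $ j = C $ i $ j"
  using pareto_frontier_tight_row[OF pareto_frontier_transpose[OF assms], of j]
  by (simp add: transpose_def add.commute)

section \<open>The dynamics\<close>

lemma constant_velocity:
  fixes h :: "real \<Rightarrow> 'a::euclidean_space"
  assumes "a \<le> b" and cont: "continuous_on {a..b} h"
    and deriv: "\<And>s. a \<le> s \<Longrightarrow> s < b \<Longrightarrow> (h has_vector_derivative u) (at s within {a..<b})"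
  shows "h b = h a + (b - a) *\<^sub>R u"
proof -
  have "h b - b *\<^sub>R u = h a - a *\<^sub>R u"
  proof (rule has_derivative_zero_unique_strong_interval[of "{a, b}" a b "\<lambda>s. h s - s *\<^sub>R u"])
    show "continuous_on {a..b} (\<lambda>s. h s - s *\<^sub>R u)"
      by (intro continuous_intros cont)
    fix s assume s: "s \<in> {a..b} - {a, b}"
    then have "(h has_vector_derivative u) (at s within {a<..<b})"
      by (intro has_vector_derivative_within_subset[OF deriv]) auto
    then have "(h has_vector_derivative u) (at s)"
      using s by (subst (asm) has_vector_derivative_within_open) auto
    moreover have "((\<lambda>s. s *\<^sub>R u) has_vector_derivative u) (at s)"
      by (auto simp: has_vector_derivative_def intro!: derivative_eq_intros)
    ultimately have "((\<lambda>s. h s - s *\<^sub>R u) has_vector_derivative u - u) (at s)"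
      by (rule has_vector_derivative_diff)
    then have "((\<lambda>s. h s - s *\<^sub>R u) has_vector_derivative 0) (at s within {a..b})"
      by (simp add: has_vector_derivative_at_within)
    then show "((\<lambda>s. h s - s *\<^sub>R u) has_derivative (\<lambda>_. 0)) (at s within {a..b})"
      by (simp add: has_vector_derivative_def)
  qed (use \<open>a \<le> b\<close> in auto)
  then show ?thesis
    by (simp add: algebra_simps)
qed

lemma affine_nonpos_until:
  fixes a b D :: real
  assumes "0 \<le> D" "a \<le> 0" and neg: "\<And>d. 0 \<le> d \<Longrightarrow> d < D \<Longrightarrow> a + d * b < 0"
  shows "a + D * b \<le> 0"
proof (rule ccontr)
  assume pos: "\<not> a + D * b \<le> 0"
  then have b: "0 < b"
    using assms(1,2) by (smt (verit) mult_nonneg_nonpos)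
  have "0 \<le> - a / b" "- a / b < D"
    using b pos assms(2) by (auto simp: field_simps)
  \<comment> \<open>The zero of the affine function would lie before \<open>D\<close>.\<close>
  from neg[OF this] b show False
    by simp
qed

lemma cold_sinkhorn_next_time:
  assumes "cold_sinkhorn \<mu> \<nu> C f0 g0 f g L t v w E" "l \<le> L" "t l = ereal \<tau>"
  shows "t (Suc l) = Inf {ereal s | s. ereal \<tau> \<le> ereal s \<and>
        (SUP (i, j)\<in>-E l. ereal (violation C (f \<tau>) (g \<tau>) (v l) (w l) (s - \<tau>) i j)) \<ge> 0}"
  using assms unfolding cold_sinkhorn_def by simp

lemma violation_neg_before_next_time:
  assumes t': "t' = Inf {ereal s | s. ereal \<tau> \<le> ereal s \<and>
        (SUP (i, j)\<in>-E. ereal (violation C f g v w (s - \<tau>) i j)) \<ge> 0}"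
    and "(i, j) \<notin> E" "0 \<le> d" "ereal (\<tau> + d) < t'"
  shows "violation C f g v w d i j < 0"
proof (rule ccontr)
  assume "\<not> violation C f g v w d i j < 0"
  then have "0 \<le> ereal (violation C f g v w (\<tau> + d - \<tau>) i j)"
    by simp
  also have "\<dots> \<le> (SUP (i, j)\<in>-E. ereal (violation C f g v w (\<tau> + d - \<tau>) i j))"
    by (rule SUP_upper2[of "(i, j)"]) (use assms in auto)
  finally have "t' \<le> ereal (\<tau> + d)"
    unfolding t' using \<open>0 \<le> d\<close> by (intro Inf_lower) auto
  with assms(4) show False
    by simp
qed

text \<open>The invariant at the beginning of a phase; \<open>\<tau>\<close> is the real number underlying the extended real
  starting time.\<close>

definition phase_state ::
  "real ^ 'n ^ 'm \<Rightarrow> (real \<Rightarrow> real ^ 'm) \<Rightarrow> (real \<Rightarrow> real ^ 'n) \<Rightarrow> ereal \<Rightarrow> ('m \<times> 'n) set \<Rightarrow> real \<Rightarrow> bool" where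
  "phase_state C f g t E \<tau> \<longleftrightarrow>
     t = ereal \<tau> \<and> 0 \<le> \<tau> \<and> (f \<tau>, g \<tau>) \<in> dual_polytope C \<and>
     E = {(i, j). f \<tau> $ i + g \<tau> $ j = C $ i $ j} \<and>
     (\<forall>i. \<exists>j. (i, j) \<in> E) \<and> (\<forall>j. \<exists>i. (i, j) \<in> E)"

lemma phase_state_complementary:
  fixes \<mu> :: "real ^ 'm" and \<nu> :: "real ^ 'n"
  assumes \<mu>: "\<mu> \<in> prob_simplex" "\<And>i. 0 < \<mu> $ i" and \<nu>: "\<nu> \<in> prob_simplex" "\<And>j. 0 < \<nu> $ j"
    and "phase_state C f g t E \<tau>"
  obtains Q where "complementary \<mu> \<nu> E (v_star \<mu> \<nu> E) (w_star \<mu> \<nu> E) Q"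
proof -
  obtain v w Q where c: "complementary \<mu> \<nu> E v w Q"
    using exists_complementary[OF \<nu>(1) \<mu>(2) \<nu>(2), of E] assms(5) unfolding phase_state_def by blast
  moreover have "v_star \<mu> \<nu> E = v" "w_star \<mu> \<nu> E = w"
    using complementary_imp_v_star[OF c \<mu>(2)] complementary_imp_w_star[OF c _ \<nu>(2)] \<mu>(1)
    by (auto simp: prob_simplex_def)
  ultimately show thesis
    using that by simp
qed

text \<open>Both marginals of \<open>Q\<close> are positive, so every vertex meets the support of \<open>Q\<close>, on which the
  constraints do not move. This is what keeps every vertex attached to a tight constraint.\<close>

lemma every_vertex_has_steady_edge:
  assumes c: "complementary \<mu> \<nu> E v w Q" and \<mu>: "\<And>i. 0 < \<mu> $ i" and \<nu>: "\<And>j. 0 < \<nu> $ j"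
  shows "\<exists>j. (i, j) \<in> E \<and> v $ i + w $ j = 0" and "\<exists>i. (i, j) \<in> E \<and> v $ i + w $ j = 0"
proof -
  have Q: "Q \<in> dist_on E" and eq: "0 < Q $ i $ j \<Longrightarrow> v $ i + w $ j = 0" for i j
    using c unfolding complementary_def by auto
  have edge: "(i, j) \<in> E" if "0 < Q $ i $ j" for i j
    using that Q by (force simp: dist_on_iff)
  have "0 < X_push E Q $ i" "0 < Y_push E Q $ j"
    using c \<mu>[of i] \<nu>[of j] unfolding complementary_def by auto
  then have "\<exists>j. 0 < Q $ i $ j" "\<exists>i. 0 < Q $ i $ j"
    unfolding X_push_eq_row_sum[OF Q] Y_push_eq_column_sum[OF Q]
    by (meson not_less sum_nonpos)+
  then show "\<exists>j. (i, j) \<in> E \<and> v $ i + w $ j = 0" "\<exists>i. (i, j) \<in> E \<and> v $ i + w $ j = 0"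
    using eq edge by blast+
qed

text \<open>Feasibility at the next starting time comes from two sources: a tight constraint cannot be
  violated because \<open>v\<^sub>i + w\<^sub>j \<le> 0\<close> on \<open>E\<close>, and a slack one stays slack until the phase ends.\<close>

lemma phase_state_step:
  fixes \<mu> :: "real ^ 'm" and \<nu> :: "real ^ 'n"
  assumes \<mu>: "\<mu> \<in> prob_simplex" "\<And>i. 0 < \<mu> $ i" and \<nu>: "\<nu> \<in> prob_simplex" "\<And>j. 0 < \<nu> $ j"
    and dyn: "cold_sinkhorn \<mu> \<nu> C f0 g0 f g L t v w E"
    and l: "l < L" and state: "phase_state C f g (t l) (E l) \<tau>"
  obtains \<tau>' where "phase_state C f g (t (Suc l)) (E (Suc l)) \<tau>'"
proof -
  have cont: "continuous_on {0..} f" "continuous_on {0..} g"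
    using dyn unfolding cold_sinkhorn_def by auto
  have tl: "t l = ereal \<tau>" and \<tau>: "0 \<le> \<tau>" and feasible: "f \<tau> $ i + g \<tau> $ j \<le> C $ i $ j"
    and tight: "(i, j) \<in> E l \<longleftrightarrow> f \<tau> $ i + g \<tau> $ j = C $ i $ j" for i j
    using state unfolding phase_state_def dual_polytope_def by auto
  note next_time = cold_sinkhorn_next_time[OF dyn less_imp_le[OF l] tl]
  then have "ereal \<tau> \<le> t (Suc l)"
    by (auto intro!: Inf_greatest)
  moreover have "t (Suc l) < \<infinity>"
    using dyn l unfolding cold_sinkhorn_def by blast
  ultimately obtain \<tau>' where \<tau>': "t (Suc l) = ereal \<tau>'" "\<tau> \<le> \<tau>'"
    by (cases "t (Suc l)") auto
  have interval: "{r. t l \<le> ereal r \<and> ereal r < t (Suc l)} = {\<tau>..<\<tau>'}"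
    by (auto simp: tl \<tau>')
  have deriv: "(f has_vector_derivative v l) (at s within {\<tau>..<\<tau>'})"
      "(g has_vector_derivative w l) (at s within {\<tau>..<\<tau>'})" if "\<tau> \<le> s" "s < \<tau>'" for s
  proof -
    have "t l \<le> ereal s \<and> ereal s < t (Suc l)"
      using that by (simp add: tl \<tau>')
    then show "(f has_vector_derivative v l) (at s within {\<tau>..<\<tau>'})"
      "(g has_vector_derivative w l) (at s within {\<tau>..<\<tau>'})"
      using dyn l unfolding cold_sinkhorn_def interval[symmetric] by (meson less_imp_le)+
  qed
  have f': "f \<tau>' = f \<tau> + (\<tau>' - \<tau>) *\<^sub>R v l"
    using \<tau> \<tau>'(2) deriv(1) by (intro constant_velocity continuous_on_subset[OF cont(1)]) auto
  have g': "g \<tau>' = g \<tau> + (\<tau>' - \<tau>) *\<^sub>R w l"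
    using \<tau> \<tau>'(2) deriv(2) by (intro constant_velocity continuous_on_subset[OF cont(2)]) auto
  have moved: "f \<tau>' $ i + g \<tau>' $ j = f \<tau> $ i + g \<tau> $ j + (\<tau>' - \<tau>) * (v l $ i + w l $ j)" for i j
    by (simp add: f' g' algebra_simps)
  have "v l = v_star \<mu> \<nu> (E l)" "w l = w_star \<mu> \<nu> (E l)"
    using dyn l unfolding cold_sinkhorn_def by auto
  then obtain Q where c: "complementary \<mu> \<nu> (E l) (v l) (w l) Q"
    using phase_state_complementary[OF \<mu> \<nu> state] by metis
  then have nonpos: "v l $ i + w l $ j \<le> 0" if "(i, j) \<in> E l" for i j
    using that unfolding complementary_def by auto
  have feasible': "f \<tau>' $ i + g \<tau>' $ j \<le> C $ i $ j" for i j
  proof (cases "(i, j) \<in> E l")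
    case True
    then have "(\<tau>' - \<tau>) * (v l $ i + w l $ j) \<le> 0"
      using nonpos \<tau>'(2) by (intro mult_nonneg_nonpos) auto
    with feasible[of i j] show ?thesis
      unfolding moved by simp
  next
    case False
    have "(f \<tau> $ i + g \<tau> $ j - C $ i $ j) + (\<tau>' - \<tau>) * (v l $ i + w l $ j) \<le> 0"
    proof (rule affine_nonpos_until)
      show "f \<tau> $ i + g \<tau> $ j - C $ i $ j + d * (v l $ i + w l $ j) < 0" if "0 \<le> d" "d < \<tau>' - \<tau>" for d
        using violation_neg_before_next_time[OF next_time False that(1)] that(2)
        by (simp add: \<tau>'(1) violation_def)
    qed (use \<tau>'(2) feasible[of i j] in auto)
    then show ?thesis
      unfolding moved by simp
  qed
  have E': "E (Suc l) = {(i, j). f \<tau>' $ i + g \<tau>' $ j = C $ i $ j}"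
    using dyn l unfolding cold_sinkhorn_def moved by (auto simp: tl \<tau>' violation_def)
  have stays: "(i, j) \<in> E (Suc l)" if "(i, j) \<in> E l" "v l $ i + w l $ j = 0" for i j
    using that by (simp add: E' moved tight)
  have "phase_state C f g (t (Suc l)) (E (Suc l)) \<tau>'"
    unfolding phase_state_def
  proof (intro conjI allI)
    show "\<exists>j. (i, j) \<in> E (Suc l)" for i
      using every_vertex_has_steady_edge(1)[OF c \<mu>(2) \<nu>(2)] stays by blast
    show "\<exists>i. (i, j) \<in> E (Suc l)" for j
      using every_vertex_has_steady_edge(2)[OF c \<mu>(2) \<nu>(2)] stays by blast
  qed (use \<tau> \<tau>' feasible' E' in \<open>auto simp: dual_polytope_def\<close>)
  then show thesis
    by (rule that)
qed

lemma phase_state_all: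
  fixes \<mu> :: "real ^ 'm" and \<nu> :: "real ^ 'n"
  assumes \<mu>: "\<mu> \<in> prob_simplex" "\<And>i. 0 < \<mu> $ i" and \<nu>: "\<nu> \<in> prob_simplex" "\<And>j. 0 < \<nu> $ j"
    and pareto: "(f0, g0) \<in> pareto_frontier C"
    and dyn: "cold_sinkhorn \<mu> \<nu> C f0 g0 f g L t v w E" and "l \<le> L"
  shows "\<exists>\<tau>. phase_state C f g (t l) (E l) \<tau>"
  using \<open>l \<le> L\<close>
proof (induction l)
  case 0
  have "phase_state C f g (t 0) (E 0) 0"
    using dyn pareto pareto_frontier_tight_row[OF pareto] pareto_frontier_tight_column[OF pareto]
    unfolding cold_sinkhorn_def phase_state_def
    by (auto simp: pareto_frontier_def zero_ereal_def)
  then show ?case ..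
next
  case (Suc l)
  then show ?case
    using phase_state_step[OF \<mu> \<nu> dyn] by (metis Suc_le_eq less_imp_le)
qed

theorem lemma3p5:
  fixes \<mu> :: "real ^ 'm" and \<nu> :: "real ^ 'n" and C :: "real ^ 'n ^ 'm"
    and f0 :: "real ^ 'm" and g0 :: "real ^ 'n"
    and f :: "real \<Rightarrow> real ^ 'm" and g :: "real \<Rightarrow> real ^ 'n"
    and L :: nat and t :: "nat \<Rightarrow> ereal"
    and v :: "nat \<Rightarrow> real ^ 'm" and w :: "nat \<Rightarrow> real ^ 'n"
    and E :: "nat \<Rightarrow> ('m \<times> 'n) set"
  assumes "\<mu> \<in> prob_simplex" and "\<nu> \<in> prob_simplex"
    and "\<And>i. 0 < \<mu> $ i" and "\<And>j. 0 < \<nu> $ j"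
    and "(f0, g0) \<in> pareto_frontier C"
    and "cold_sinkhorn \<mu> \<nu> C f0 g0 f g L t v w E"
  shows "(v L, w L) = (0, 0) \<and>
    is_arg_max (\<lambda>(x, y). x \<bullet> \<mu> + y \<bullet> \<nu>) (\<lambda>(x, y). \<forall>i j. x $ i + y $ j \<le> C $ i $ j)
      (f (real_of_ereal (t L)), g (real_of_ereal (t L)))"
proof -
  note \<mu> = assms(1,3) and \<nu> = assms(2,4) and dyn = assms(6)
  obtain \<tau> where state: "phase_state C f g (t L) (E L) \<tau>"
    using phase_state_all[OF \<mu> \<nu> assms(5) dyn] by blast
  then have tL: "t L = ereal \<tau>" and feasible: "(f \<tau>, g \<tau>) \<in> dual_polytope C"
    and tight: "(i, j) \<in> E L \<longleftrightarrow> f \<tau> $ i + g \<tau> $ j = C $ i $ j" for i j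
    unfolding phase_state_def by auto
  note next_time = cold_sinkhorn_next_time[OF dyn order_refl tL]
  have last: "t (Suc L) = \<infinity>"
    using dyn unfolding cold_sinkhorn_def by simp
  have "v L = v_star \<mu> \<nu> (E L)" "w L = w_star \<mu> \<nu> (E L)"
    using dyn unfolding cold_sinkhorn_def by auto
  then obtain Q where c: "complementary \<mu> \<nu> (E L) (v L) (w L) Q"
    using phase_state_complementary[OF \<mu> \<nu> state] by metis
  have "v L $ i + w L $ j \<le> 0" for i j
  proof (cases "(i, j) \<in> E L")
    case True
    with c show ?thesis
      unfolding complementary_def by auto
  next
    case False
    show ?thesis
    proof (rule ccontr)
      assume b: "\<not> v L $ i + w L $ j \<le> 0"
      \<comment> \<open>With positive speed, the slack constraint would become tight after the finite time \<open>?d\<close>.\<close>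
      let ?d = "(C $ i $ j - (f \<tau> $ i + g \<tau> $ j)) / (v L $ i + w L $ j)"
      have "0 \<le> ?d"
        using b feasible by (auto simp: dual_polytope_def intro!: divide_nonneg_nonneg)
      from violation_neg_before_next_time[OF next_time False this] b show False
        by (simp add: violation_def last)
    qed
  qed
  then have zero: "v L = 0" "w L = 0"
    using complementary_eq_0_if_nonpos[OF c] \<mu> \<nu> by (simp_all add: prob_simplex_def)
  have "Q \<in> dist_on (E L)" "X_push (E L) Q = \<mu>" "Y_push (E L) Q = \<nu>"
    using c unfolding complementary_def zero by (auto simp: vec_eq_iff)
  from tight_coupling_imp_optimal[OF this feasible] tight zero show ?thesis
    by (simp add: tL)
qed

end
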